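(* Let $p,q,r\in\mathbb{Z}$ with $\min\{p+q+1,\,p-q\}\geq 0$. Then \[ \frac{1}{\pi}=\frac{(\frac{1}{2})_{p+q-r+1}(\frac{1}{2})_{p-q-r}}{(\frac{1}{2})_{r}} \sum_{k=0}^{\infty}\frac{(\frac{3}{2})_{k+2p}(\frac{3}{2})_{k+2q}(-\frac{1}{2})_{k-2q}(\frac{1}{2})_{k+r}} {k!\,(k+p+q+1)!\,(k+p-q)!\,(\frac{3}{2})_{k+2p-2r}}\cdot\frac{6k+4p+3}{4^{k+r+1}}. \]
   Context: For a complex number $x$ and an integer $n$ (possibly negative), the shifted factorial is defined by $(x)_n=\Gamma(x+n)/\Gamma(x)$, where $\Gamma$ is the Gamma function. *)

theory Defs
  imports "HOL-Analysis.Analysis"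
begin

(* The library sets Gamma to 0 at its poles (the nonpositive integers), so this agrees with the
   usual quotient whenever neither x nor x + n is such a pole, in particular for every
   half-integer x.  The library's pochhammer covers only n >= 0. *)
definition shifted_factorial :: "complex \<Rightarrow> int \<Rightarrow> complex" where
  "shifted_factorial x n = Gamma (x + of_int n) / Gamma x"

(* The factorials of integer expressions are taken through nat, which truncates negative
   arguments to 0; under p + q + 1 >= 0 and p - q >= 0 no truncation occurs for any k. *)
definition pi_series_term :: "int \<Rightarrow> int \<Rightarrow> int \<Rightarrow> nat \<Rightarrow> complex" where
  "pi_series_term p q r k =
     (shifted_factorial (3/2) (int k + 2 * p) * shifted_factorial (3/2) (int k + 2 * q)
        * shifted_factorial (-1/2) (int k - 2 * q) * shifted_factorial (1/2) (int k + r))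
     / (fact k * fact (nat (int k + p + q + 1)) * fact (nat (int k + p - q))
        * shifted_factorial (3/2) (int k + 2 * p - 2 * r))
     * (of_int (6 * int k + 4 * p + 3) / 4 powi (int k + r + 1))"

end

theory Submission
  imports Defs
begin

text \<open>
  With \<open>u = p + q + 2\<close>, \<open>v = p - q + 1\<close> and \<open>c = r + 1/2\<close>, the series is up to a constant factor the
  special case of a sum \<open>S(u, v)\<close> that can be evaluated for arbitrary complex \<open>u\<close>, \<open>v\<close>, \<open>c\<close>; in it,
  \<open>a = u + v - 3/2\<close> and \<open>w = a + 1 - 2c\<close>.  The combination
  \<open>u w t(u, v, k) - a (u - c) t(u + 1, v, k)\<close> of the summands telescopes in \<open>k\<close> (a Wilf--Zeilberger
  pair), so the quotient of \<open>S(u, v)\<close> by the conjectural Gamma product is invariant under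
  \<open>u \<mapsto> u + 1\<close> and, the summand being symmetric, under \<open>v \<mapsto> v + 1\<close>.  As both parameters tend to
  infinity only the term \<open>k = 0\<close> survives (Tannery), and the asymptotics of the Gamma function give the
  value \<open>4\<^sup>c\<close> of the quotient.  The powers of \<open>\<pi>\<close> then come from the reflection formula.
\<close>

section \<open>The summand and its term ratio\<close>

text \<open>With a = u + v - 3/2 and b = u - v + 1/2 the numerator parameters are a, b, 1 - b and c,
  while u = (a + b + 1)/2 and v = (a - b)/2 + 1. In terms of \<open>u\<close> and \<open>v\<close>
  the symmetry b <-> 1 - b becomes an exchange of the two arguments, and the shift that telescopes
  acts on one argument alone.\<close>

definition cubic_term :: "complex \<Rightarrow> complex \<Rightarrow> complex \<Rightarrow> nat \<Rightarrow> complex" where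
  "cubic_term u v c k =
     (u + v - 3/2 + 3 * of_nat k) * pochhammer (u + v - 3/2) k
       * pochhammer (u - v + 1/2) k * pochhammer (v - u + 1/2) k * pochhammer c k
     / (fact k * pochhammer u k * pochhammer v k * pochhammer (u + v - 1/2 - 2 * c) k * 4 ^ k)"

lemma cubic_term_commute: "cubic_term v u c k = cubic_term u v c k"
  by (simp add: cubic_term_def mult_ac add_ac)

lemma cubic_term_0: "cubic_term u v c 0 = u + v - 3/2"
  by (simp add: cubic_term_def)

lemma add_of_nat_neq_0:
  fixes z :: complex
  assumes "z \<notin> \<int>\<^sub>\<le>\<^sub>0"
  shows "z + of_nat n \<noteq> 0"
  using assms plus_of_nat_eq_0_imp by blast

lemma add_of_nat_notin_nonpos_Ints:
  fixes z :: complex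
  assumes "z \<notin> \<int>\<^sub>\<le>\<^sub>0"
  shows "z + of_nat n \<notin> \<int>\<^sub>\<le>\<^sub>0"
proof
  assume "z + of_nat n \<in> \<int>\<^sub>\<le>\<^sub>0"
  then obtain m where "z + of_nat n = - of_nat m"
    by (elim nonpos_Ints_cases')
  then have "z + of_nat (n + m) = 0"
    by (simp add: eq_neg_iff_add_eq_0 add_ac)
  with add_of_nat_neq_0[OF assms] show False by blast
qed

lemma pochhammer_neq_0:
  fixes z :: complex
  assumes "z \<notin> \<int>\<^sub>\<le>\<^sub>0"
  shows "pochhammer z n \<noteq> 0"
  using assms by (auto simp: pochhammer_eq_0_iff)

text \<open>This ratio drives the convergence proof, the uniform bound and the termwise limits. The
  assumption serves the factor a + 3k, which is replaced rather than extended when \<open>k\<close>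
  grows and so must be cancelled. The remaining factors are only appended, and splitting off
  appended factors is valid even where division by zero yields 0.\<close>

lemma cubic_term_Suc:
  assumes "u + v - 3/2 \<notin> \<int>\<^sub>\<le>\<^sub>0"
  shows "cubic_term u v c (Suc k) = cubic_term u v c k *
    ((u + v - 3/2 + 3 * of_nat k + 3) / (u + v - 3/2 + 3 * of_nat k) *
     ((u + v - 3/2 + of_nat k) / (u + v - 1/2 - 2 * c + of_nat k)) *
     ((u - v + 1/2 + of_nat k) / (u + of_nat k)) * ((v - u + 1/2 + of_nat k) / (v + of_nat k)) *
     ((c + of_nat k) / (1 + of_nat k)) / 4)"
proof -
  have "u + v - 3/2 + 3 * of_nat k \<noteq> 0"
    using add_of_nat_neq_0[OF assms, of "3 * k"] by simp
  then have d: "u + v - 3/2 + 3 * of_nat k + 3 = u + v - 3/2 + 3 * (1 + of_nat k)"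
      "u + v - 3/2 + 3 * of_nat k \<noteq> 0"
    by simp_all
  have "(d' * (A * x1) * (B * x2) * (Q * x3) * (C * x4))
        / ((m * F) * (U * y1) * (V * y2) * (W * y3) * (4 * P)) =
      d * A * B * Q * C / (F * U * V * W * P) *
        (d' / d * (x1 / y3) * (x2 / y1) * (x3 / y2) * (x4 / m) / 4)"
    if "d \<noteq> 0" for d d' A B Q C F U V W P x1 x2 x3 x4 y1 y2 y3 m :: complex
    using that by (simp add: mult_ac)
  from this[OF d(2)] show ?thesis
    unfolding cubic_term_def pochhammer_Suc fact_Suc power_Suc of_nat_Suc d(1) .
qed

section \<open>Limits of term ratios and convergence\<close>

lemma tendsto_shift_quotient:
  fixes x y :: "'a :: real_normed_field"
  assumes "m > 0"
  shows "(\<lambda>n. (x + of_nat (m * n)) / (y + of_nat (m * n))) \<longlonglongrightarrow> 1"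
proof -
  have "filterlim (\<lambda>n. m * n) at_top sequentially"
    using assms by (simp add: filterlim_subseq strict_mono_def)
  moreover have "(\<lambda>n. (x + of_nat n) / (y + of_nat n)) \<longlonglongrightarrow> 1"
  proof (rule Lim_transform_eventually)
    have "(\<lambda>n. inverse (of_nat n)) \<longlonglongrightarrow> (0::'a)"
      by (rule lim_inverse_n)
    then have "(\<lambda>n. (x * inverse (of_nat n) + 1) / (y * inverse (of_nat n) + 1)) \<longlonglongrightarrow>
          (x * 0 + 1) / (y * 0 + 1)"
      by (intro tendsto_intros) auto
    then show "(\<lambda>n. (x * inverse (of_nat n) + 1) / (y * inverse (of_nat n) + 1)) \<longlonglongrightarrow> 1"
      by simp
    show "\<forall>\<^sub>F n in sequentially. (x * inverse (of_nat n) + 1) / (y * inverse (of_nat n) + 1) =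
            (x + of_nat n) / (y + of_nat n)"
      using eventually_gt_at_top[of 0]
    proof eventually_elim
      case (elim n)
      then have "x * inverse (of_nat n) + 1 = (x + of_nat n) / of_nat n"
                "y * inverse (of_nat n) + 1 = (y + of_nat n) / of_nat n"
        by (simp_all add: field_simps)
      with elim show ?case by simp
    qed
  qed
  ultimately show ?thesis
    by (rule filterlim_compose[rotated])
qed

text \<open>The ratio test in multiplicative form: a recurrence instead of a quotient of consecutive
  terms allows terms that vanish.\<close>

lemma summable_ratio_limit:
  fixes f :: "nat \<Rightarrow> 'a :: {banach, real_normed_field}"
  assumes "\<And>n. f (Suc n) = f n * \<rho> n" and "\<rho> \<longlonglongrightarrow> L" and "norm L < 1"
  shows "summable f"
proof -
  obtain d where d: "norm L < d" "d < 1"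
    using assms(3) dense by blast
  have "(\<lambda>n. norm (\<rho> n)) \<longlonglongrightarrow> norm L"
    using assms(2) by (rule tendsto_norm)
  then have "\<forall>\<^sub>F n in sequentially. norm (\<rho> n) < d"
    using d(1) by (rule order_tendstoD)
  then obtain N where N: "\<And>n. n \<ge> N \<Longrightarrow> norm (\<rho> n) < d"
    by (auto simp: eventually_sequentially)
  show ?thesis
  proof (rule summable_ratio_test[OF d(2)])
    fix n assume "n \<ge> N"
    then show "norm (f (Suc n)) \<le> d * norm (f n)"
      using N[of n] by (simp add: assms(1) norm_mult mult.commute mult_right_mono)
  qed
qed

text \<open>Every quotient in the term ratio tends to 1, so the ratio itself tends to 1/4.\<close>

lemma summable_cubic_term:
  assumes "u + v - 3/2 \<notin> \<int>\<^sub>\<le>\<^sub>0"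
  shows "summable (cubic_term u v c)"
proof (rule summable_ratio_limit)
  show "cubic_term u v c (Suc k) = cubic_term u v c k *
    ((u + v - 3/2 + 3 * of_nat k + 3) / (u + v - 3/2 + 3 * of_nat k) *
     ((u + v - 3/2 + of_nat k) / (u + v - 1/2 - 2 * c + of_nat k)) *
     ((u - v + 1/2 + of_nat k) / (u + of_nat k)) * ((v - u + 1/2 + of_nat k) / (v + of_nat k)) *
     ((c + of_nat k) / (1 + of_nat k)) / 4)" for k
    by (rule cubic_term_Suc[OF assms])
  note q1 = tendsto_shift_quotient[of 1, simplified]
  have "(\<lambda>n. (u + v - 3/2 + 3 * of_nat n + 3) / (u + v - 3/2 + 3 * of_nat n)) \<longlonglongrightarrow> 1"
    using tendsto_shift_quotient[of 3 "u + v - 3/2 + 3" "u + v - 3/2"]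
    by (simp add: add_ac)
  then show "(\<lambda>k. (u + v - 3/2 + 3 * of_nat k + 3) / (u + v - 3/2 + 3 * of_nat k) *
     ((u + v - 3/2 + of_nat k) / (u + v - 1/2 - 2 * c + of_nat k)) *
     ((u - v + 1/2 + of_nat k) / (u + of_nat k)) * ((v - u + 1/2 + of_nat k) / (v + of_nat k)) *
     ((c + of_nat k) / (1 + of_nat k)) / 4) \<longlonglongrightarrow> 1 * 1 * 1 * 1 * 1 / 4"
    by (intro tendsto_mult tendsto_divide[of _ _ _ "\<lambda>_. 4"] q1 tendsto_const) auto
qed simp

section \<open>The Wilf-Zeilberger pair\<close>

text \<open>The right-hand side is the certificate of the pair at the upper end; there is no
  contribution from the lower end. In the induction step everything is a rational multiple of one
  common hypergeometric term, which leaves a polynomial identity.\<close>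

lemma cubic_term_telescope:
  assumes u: "u \<notin> \<int>\<^sub>\<le>\<^sub>0" and v: "v \<notin> \<int>\<^sub>\<le>\<^sub>0" and w: "u + v - 1/2 - 2 * c \<notin> \<int>\<^sub>\<le>\<^sub>0"
  shows "(\<Sum>k\<le>n. u * (u + v - 1/2 - 2 * c) * cubic_term u v c k
                 - (u + v - 3/2) * (u - c) * cubic_term (u + 1) v c k) =
    - (u * (u + v - 1/2 - 2 * c) *
      (pochhammer (u + v - 3/2) (Suc n) * pochhammer (u - v + 1/2) (Suc n)
        * pochhammer (v - u + 1/2) n * pochhammer c (Suc n)
      / (fact n * pochhammer u (Suc n) * pochhammer v n
        * pochhammer (u + v - 1/2 - 2 * c) (Suc n) * 4 ^ n)))"
proof (induction n)
  case 0
  have "u \<noteq> 0" "u + v - 1/2 - 2 * c \<noteq> 0"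
    using add_of_nat_neq_0[OF u, of 0] add_of_nat_neq_0[OF w, of 0] by simp_all
  then have "u * (u + v - 1/2 - 2 * c) * (x / (u * (u + v - 1/2 - 2 * c))) = x" for x
    by simp
  moreover have "u * (u + v - 1/2 - 2 * c) * (u + v - 3/2)
      - (u + v - 3/2) * (u - c) * (u + 1 + v - 3/2) = - ((u + v - 3/2) * (u - v + 1/2) * c)"
    by (simp add: field_simps)
  ultimately show ?case
    by (simp add: cubic_term_0 del: minus_mult_minus mult_minus_left)
next
  case (Suc n)
  define a b w' m where defs: "a = u + v - 3/2" "b = u - v + 1/2" "w' = u + v - 1/2 - 2 * c"
    "m = (of_nat (Suc n) :: complex)"
  define A B Q C U V W where Defs: "A = pochhammer a (Suc n)" "B = pochhammer b (Suc n)"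
    "Q = pochhammer (1 - b) n" "C = pochhammer c (Suc n)" "U = pochhammer u (Suc n)"
    "V = pochhammer v n" "W = pochhammer w' (Suc n)"
  \<comment> \<open>The common term: the certificate at \<open>n\<close> is
    \<open>- (u * w' * H)\<close>. Both summands and the certificate at \<open>Suc n\<close> are
    written as \<open>H\<close> times a rational function of \<open>m\<close>, where
    \<open>m\<close> is n + 1.\<close>
  define H where "H = A * B * Q * C / (fact n * U * V * W * 4 ^ n)"
  have b1: "v - u + 1/2 = 1 - b" "u + 1 - v + 1/2 = b + 1" "v - (u + 1) + 1/2 = - b"
     "u + 1 + v - 3/2 = a + 1" "u + 1 + v - 1/2 - 2 * c = w' + 1"
    by (simp_all add: defs)
  have m: "of_nat n = m - 1" by (simp add: defs)
  have e: "1 - b + (m - 1) = m - b" "v + (m - 1) = v + m - 1" by simp_all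
  have nz: "u \<noteq> 0" "w' \<noteq> 0" "m \<noteq> 0" "u + m \<noteq> 0" "w' + m \<noteq> 0" "v + m - 1 \<noteq> 0"
    "fact n \<noteq> (0::complex)" "U \<noteq> 0" "V \<noteq> 0" "W \<noteq> 0"
    using add_of_nat_neq_0[OF u, of 0] add_of_nat_neq_0[OF w, of 0]
      add_of_nat_neq_0[OF u, of "Suc n"] add_of_nat_neq_0[OF w, of "Suc n"]
      add_of_nat_neq_0[OF v, of n] pochhammer_neq_0[OF u] pochhammer_neq_0[OF v]
      pochhammer_neq_0[OF w] of_nat_neq_0[of n, where ?'a = complex]
    unfolding defs Defs by (simp_all add: add_ac del: of_nat_Suc) (simp_all add: algebra_simps)
  have shift': "z * pochhammer (z + 1) (Suc n) = pochhammer z (Suc n) * (z + m)" for z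
    unfolding pochhammer_rec[symmetric] pochhammer_Suc[of z "Suc n"] defs(4) ..
  then have shift: "pochhammer (z + 1) (Suc n) = pochhammer z (Suc n) * (z + m) / z" if "z \<noteq> 0" for z
    using that by (metis nonzero_mult_div_cancel_left)
  \<comment> \<open>Since \<open>b\<close> may vanish, the two factors are not shifted separately:
    the \<open>b\<close> split off the second one is what shifts the first one down to
    \<open>B\<close>.\<close>
  have "pochhammer (- b) (Suc n) = - b * Q"
    using pochhammer_rec[of "- b" n] by (simp add: Defs(3))
  then have "pochhammer (b + 1) (Suc n) * pochhammer (- b) (Suc n) = - (b * pochhammer (b + 1) (Suc n) * Q)"
    by (simp only:) simp
  then have bb: "pochhammer (b + 1) (Suc n) * pochhammer (- b) (Suc n) = - (B * (b + m) * Q)"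
    unfolding shift' Defs(2) .
  note aa = shift'[of a, folded Defs(1)]
  have t: "cubic_term u v c (Suc n) = H * ((a + 3 * m) * (m - b) / (4 * m * (v + m - 1)))"
    unfolding cubic_term_def b1 defs(1-3)[symmetric] defs(4)[symmetric] H_def
    unfolding pochhammer_Suc[of "1 - b" n] pochhammer_Suc[of v n] Defs[symmetric] fact_Suc m
       power_Suc defs(4)[symmetric] e
    by (simp add: mult_ac)
  \<comment> \<open>The factor \<open>a\<close> stays with
    \<open>pochhammer (a + 1) (Suc n)\<close>, so that \<open>aa\<close> applies without a division
    by \<open>a\<close>, which may be 0.\<close>
  have "a * cubic_term (u + 1) v c (Suc n) =
     (a + 1 + 3 * m) * (a * pochhammer (a + 1) (Suc n))
       * (pochhammer (b + 1) (Suc n) * pochhammer (- b) (Suc n)) * C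
     / (fact (Suc n) * pochhammer (u + 1) (Suc n) * pochhammer v (Suc n) * pochhammer (w' + 1) (Suc n) * 4 ^ Suc n)"
    unfolding cubic_term_def b1 defs(4)[symmetric] Defs by simp
  also have "\<dots> = - u * w' * (H * ((a + 1 + 3 * m) * (a + m) * (b + m)
       / (4 * m * (u + m) * (v + m - 1) * (w' + m))))"
    unfolding bb aa shift[OF nz(1)] shift[OF nz(2)] pochhammer_Suc[of v n] Defs(5-7)[symmetric] H_def
       fact_Suc m power_Suc defs(4)[symmetric] e
    by (simp add: mult_ac)
  finally have t': "a * cubic_term (u + 1) v c (Suc n) = \<dots>" .
  \<comment> \<open>This is the induction step after division by \<open>u * w' * H\<close>.\<close>
  have key: "- ((a + m) * (b + m) * (m - b) * (c + m) / (4 * m * (u + m) * (v + m - 1) * (w' + m))) + 1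
     = (a + 3 * m) * (m - b) / (4 * m * (v + m - 1))
       + (u - c) * ((a + 1 + 3 * m) * (a + m) * (b + m) / (4 * m * (u + m) * (v + m - 1) * (w' + m)))"
  proof -
    have general: "- (X / D) + 1 = Y / E + (u - c) * (Z / D)"
      if "D = E * G" "E \<noteq> 0" "G \<noteq> 0" "D - X = Y * G + (u - c) * Z" for X D Y E Z G :: complex
      using that by (simp add: field_simps)
    have poly: "4 * m * (u + m) * (v + m - 1) * (w' + m) - (a + m) * (b + m) * (m - b) * (c + m)
        = (a + 3 * m) * (m - b) * ((u + m) * (w' + m))
          + (u - c) * ((a + 1 + 3 * m) * (a + m) * (b + m))"
    proof -
      \<comment> \<open>The relations between the parameters leave \<open>u\<close>,
        \<open>b\<close>, \<open>c\<close>, \<open>m\<close> as independent variables. The 1/2 in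
        \<open>v\<close> is absorbed into the factor 4 first, so that the identity handed to
        \<open>algebra\<close> has integer coefficients.\<close>
      have v: "v = u - b + 1/2" and a: "a = 2 * u - b - 1" and w: "w' = 2 * u - b - 2 * c"
        by (simp_all add: defs)
      have "4 * m * (u + m) * (v + m - 1) * (w' + m) - (a + m) * (b + m) * (m - b) * (c + m)
        = 2 * m * (u + m) * (2 * u - 2 * b + 2 * m - 1) * (w' + m) - (a + m) * (b + m) * (m - b) * (c + m)"
        unfolding v by simp
      also have "\<dots> = (a + 3 * m) * (m - b) * ((u + m) * (w' + m))
          + (u - c) * ((a + 1 + 3 * m) * (a + m) * (b + m))"
        unfolding a w by algebra
      finally show ?thesis .
    qed
    show ?thesis
      by (rule general[OF _ _ _ poly]) (use nz in \<open>simp_all only: mult_eq_0_iff mult_ac\<close>, simp_all)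
  qed
  have H': "pochhammer a (Suc (Suc n)) * pochhammer b (Suc (Suc n))
        * pochhammer (1 - b) (Suc n) * pochhammer c (Suc (Suc n))
      / (fact (Suc n) * pochhammer u (Suc (Suc n)) * pochhammer v (Suc n)
        * pochhammer w' (Suc (Suc n)) * 4 ^ Suc n) =
      H * ((a + m) * (b + m) * (m - b) * (c + m) / (4 * m * (u + m) * (v + m - 1) * (w' + m)))"
    unfolding pochhammer_Suc[of _ "Suc n"] pochhammer_Suc[of "1 - b" n] pochhammer_Suc[of v n]
      fact_Suc m power_Suc Defs[symmetric] defs(4)[symmetric] H_def e
    by (simp add: mult_ac)
  have IH: "(\<Sum>k\<le>n. u * w' * cubic_term u v c k - a * (u - c) * cubic_term (u + 1) v c k) = - (u * w' * H)"
    using Suc.IH unfolding b1 defs(1-3)[symmetric] Defs[symmetric] H_def .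
  have "(\<Sum>k\<le>Suc n. u * w' * cubic_term u v c k - a * (u - c) * cubic_term (u + 1) v c k) =
     - (u * w' * H) + (u * w' * cubic_term u v c (Suc n) - (u - c) * (a * cubic_term (u + 1) v c (Suc n)))"
    unfolding sum.atMost_Suc IH by (simp add: mult_ac)
  also have "\<dots> = u * w' * H * ((a + 3 * m) * (m - b) / (4 * m * (v + m - 1))
       + (u - c) * ((a + 1 + 3 * m) * (a + m) * (b + m) / (4 * m * (u + m) * (v + m - 1) * (w' + m))) - 1)"
  proof -
    have "- (u * w' * H) + (u * w' * (H * Y) - d * (- u * w' * (H * Z))) = u * w' * H * (Y + d * Z - 1)"
      for Y Z d :: complex
      by (simp add: algebra_simps)
    then show ?thesis unfolding t t' .
  qed
  also have "\<dots> = - (u * w' * (H * ((a + m) * (b + m) * (m - b) * (c + m)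
        / (4 * m * (u + m) * (v + m - 1) * (w' + m)))))"
    unfolding key[symmetric] by simp
  finally show ?case
    unfolding b1 defs(1-3)[symmetric] H' .
qed

text \<open>The telescoped identity in the limit: the certificate tends to 0 because its own term
  ratio tends to 1/4, so it is even summable.\<close>

lemma suminf_cubic_term_step:
  assumes u: "u \<notin> \<int>\<^sub>\<le>\<^sub>0" and v: "v \<notin> \<int>\<^sub>\<le>\<^sub>0" and w: "u + v - 1/2 - 2 * c \<notin> \<int>\<^sub>\<le>\<^sub>0"
    and a: "u + v - 3/2 \<notin> \<int>\<^sub>\<le>\<^sub>0"
  shows "u * (u + v - 1/2 - 2 * c) * suminf (cubic_term u v c)
       = (u + v - 3/2) * (u - c) * suminf (cubic_term (u + 1) v c)"
proof -
  define H where "H n = pochhammer (u + v - 3/2) (Suc n) * pochhammer (u - v + 1/2) (Suc n)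
        * pochhammer (v - u + 1/2) n * pochhammer c (Suc n)
      / (fact n * pochhammer u (Suc n) * pochhammer v n
        * pochhammer (u + v - 1/2 - 2 * c) (Suc n) * 4 ^ n)" for n
  have "summable H"
  proof (rule summable_ratio_limit)
    have "(A * x1) * (B * x2) * (Q * x3) * (C * x4)
        / ((m * F) * (U * y1) * (V * y2) * (W * y3) * (4 * P)) =
      A * B * Q * C / (F * U * V * W * P) *
        ((x1 / y3) * (x2 / y1) * (x3 / y2) * (x4 / m) / 4)"
      for A B Q C F U V W P x1 x2 x3 x4 y1 y2 y3 m :: complex
      by (simp add: mult_ac)
    from this show "H (Suc n) = H n *
     (((u + v - 3/2 + (1 + of_nat n)) / (u + v - 1/2 - 2 * c + (1 + of_nat n))) *
     ((u - v + 1/2 + (1 + of_nat n)) / (u + (1 + of_nat n))) * ((v - u + 1/2 + of_nat n) / (v + of_nat n)) *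
     ((c + (1 + of_nat n)) / (1 + of_nat n)) / 4)" for n
      unfolding H_def pochhammer_Suc[of _ "Suc n"] pochhammer_Suc[of v n] pochhammer_Suc[of "v - u + 1/2" n]
        fact_Suc power_Suc of_nat_Suc .
    note q1 = tendsto_shift_quotient[of 1, simplified]
    have q2: "(\<lambda>n. (x + (1 + of_nat n)) / (y + (1 + of_nat n))) \<longlonglongrightarrow> 1" for x y :: complex
      using q1[of "x + 1" "y + 1"] by (simp add: add.assoc)
    have q3: "(\<lambda>n. (x + (1 + of_nat n)) / (1 + of_nat n)) \<longlonglongrightarrow> 1" for x :: complex
      using q1[of "x + 1" "1"] by (simp add: add.assoc)
    show "(\<lambda>n. ((u + v - 3/2 + (1 + of_nat n)) / (u + v - 1/2 - 2 * c + (1 + of_nat n))) *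
     ((u - v + 1/2 + (1 + of_nat n)) / (u + (1 + of_nat n))) * ((v - u + 1/2 + of_nat n) / (v + of_nat n)) *
     ((c + (1 + of_nat n)) / (1 + of_nat n)) / 4) \<longlonglongrightarrow> 1 * 1 * 1 * 1 / 4"
      by (intro tendsto_mult tendsto_divide[of _ _ _ "\<lambda>_. 4"] q1 q2 q3 tendsto_const) auto
  qed simp
  then have H0: "H \<longlonglongrightarrow> 0"
    by (rule summable_LIMSEQ_zero)
  have a1: "u + 1 + v - 3/2 \<notin> \<int>\<^sub>\<le>\<^sub>0"
    using add_of_nat_notin_nonpos_Ints[OF a, of 1] by (simp add: add_ac diff_add_eq)
  have "(\<lambda>k. u * (u + v - 1/2 - 2 * c) * cubic_term u v c k
                 - (u + v - 3/2) * (u - c) * cubic_term (u + 1) v c k)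
       sums (u * (u + v - 1/2 - 2 * c) * suminf (cubic_term u v c)
       - (u + v - 3/2) * (u - c) * suminf (cubic_term (u + 1) v c))"
    by (intro sums_diff sums_mult summable_sums summable_cubic_term a a1)
  then have "(\<lambda>n. - (u * (u + v - 1/2 - 2 * c) * H n)) \<longlonglongrightarrow>
      u * (u + v - 1/2 - 2 * c) * suminf (cubic_term u v c)
       - (u + v - 3/2) * (u - c) * suminf (cubic_term (u + 1) v c)"
    unfolding sums_def_le cubic_term_telescope[OF u v w] H_def .
  moreover have "(\<lambda>n. - (u * (u + v - 1/2 - 2 * c) * H n)) \<longlonglongrightarrow> - (u * (u + v - 1/2 - 2 * c) * 0)"
    by (intro tendsto_intros H0)
  ultimately show ?thesis
    using LIMSEQ_unique by fastforce
qed

section \<open>The Gamma quotient and its invariance\<close>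

text \<open>The six excluded pole conditions are those of the six Gamma values in
  \<open>cubic_quotient\<close>; they make these values nonzero and the functional equation of Gamma
  applicable.\<close>

definition cubic_regular :: "complex \<Rightarrow> complex \<Rightarrow> complex \<Rightarrow> bool" where
  "cubic_regular u v c \<longleftrightarrow> u \<notin> \<int>\<^sub>\<le>\<^sub>0 \<and> v \<notin> \<int>\<^sub>\<le>\<^sub>0 \<and> u - c \<notin> \<int>\<^sub>\<le>\<^sub>0 \<and> v - c \<notin> \<int>\<^sub>\<le>\<^sub>0
     \<and> u + v - 3/2 \<notin> \<int>\<^sub>\<le>\<^sub>0 \<and> u + v - 1/2 - 2 * c \<notin> \<int>\<^sub>\<le>\<^sub>0"

text \<open>The sum divided by the expected product of Gamma values, without the factor 4 to the
  power \<open>c\<close>.\<close>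

definition cubic_quotient :: "complex \<Rightarrow> complex \<Rightarrow> complex \<Rightarrow> complex" where
  "cubic_quotient u v c = suminf (cubic_term u v c) * Gamma (u + v - 3/2) * Gamma (u - c) * Gamma (v - c)
     / (Gamma u * Gamma v * Gamma (u + v - 1/2 - 2 * c))"

lemma cubic_regular_commute: "cubic_regular v u c = cubic_regular u v c"
  by (auto simp: cubic_regular_def add_ac)

lemma cubic_quotient_commute: "cubic_quotient v u c = cubic_quotient u v c"
  by (simp add: cubic_quotient_def cubic_term_commute[of v u, abs_def] mult_ac add_ac)

lemma cubic_regular_step:
  assumes "cubic_regular u v c"
  shows "cubic_regular (u + 1) v c"
proof -
  have *: "z + 1 \<notin> \<int>\<^sub>\<le>\<^sub>0" if "z \<notin> \<int>\<^sub>\<le>\<^sub>0" for z :: complex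
    using add_of_nat_notin_nonpos_Ints[OF that, of 1] by simp
  show ?thesis
    using assms *[of u] *[of "u - c"] *[of "u + v - 3/2"] *[of "u + v - 1/2 - 2 * c"]
    unfolding cubic_regular_def by (simp add: algebra_simps)
qed

text \<open>The functional equation of Gamma produces the factor a (u - c) / (u w), which is exactly
  the factor relating the two sums in \<open>suminf_cubic_term_step\<close>.\<close>

lemma cubic_quotient_step:
  assumes "cubic_regular u v c"
  shows "cubic_quotient (u + 1) v c = cubic_quotient u v c"
proof -
  define a w where aw: "a = u + v - 3/2" "w = u + v - 1/2 - 2 * c"
  note R = assms[unfolded cubic_regular_def, folded aw]
  have nz: "u \<noteq> 0" "u - c \<noteq> 0" "a \<noteq> 0" "w \<noteq> 0"
    "Gamma u \<noteq> 0" "Gamma v \<noteq> 0" "Gamma w \<noteq> 0"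
    using R by (auto simp: Gamma_eq_zero_iff)
  have eq: "u + 1 + v - 3/2 = a + 1" "u + 1 + v - 1/2 - 2 * c = w + 1" "u + 1 - c = (u - c) + 1"
    by (simp_all add: aw)
  have G: "Gamma (a + 1) = a * Gamma a" "Gamma (w + 1) = w * Gamma w" "Gamma (u + 1) = u * Gamma u"
     "Gamma (u - c + 1) = (u - c) * Gamma (u - c)"
    using R by (simp_all add: Gamma_plus1)
  have step: "a * (u - c) * suminf (cubic_term (u + 1) v c) = u * w * suminf (cubic_term u v c)"
    using suminf_cubic_term_step[of u v c] R by (simp add: aw)
  have "cubic_quotient (u + 1) v c = (a * (u - c) * suminf (cubic_term (u + 1) v c))
     * Gamma a * Gamma (u - c) * Gamma (v - c) / (u * Gamma u * Gamma v * (w * Gamma w))"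
    unfolding cubic_quotient_def eq G by simp
  also have "\<dots> = cubic_quotient u v c"
    unfolding step cubic_quotient_def aw[symmetric] using nz by (simp add: mult.assoc)
  finally show ?thesis .
qed

lemma cubic_quotient_shift:
  assumes "cubic_regular u v c"
  shows "cubic_regular (u + of_nat n) (v + of_nat n) c"
    and "cubic_quotient (u + of_nat n) (v + of_nat n) c = cubic_quotient u v c"
proof (induction n)
  case (Suc n)
  define u' v' where "u' = u + of_nat n" "v' = v + of_nat n"
  note IH = Suc[folded u'_v'_def]
  have eq: "u + of_nat (Suc n) = u' + 1" "v + of_nat (Suc n) = v' + 1"
    by (simp_all add: u'_v'_def)
  \<comment> \<open>The step in the second argument is the step in the first one with the arguments
    exchanged.\<close>
  have R1: "cubic_regular v' (u' + 1) c"
    using cubic_regular_step[OF IH(1)] by (simp add: cubic_regular_commute)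
  {
    case 1
    show ?case
      using cubic_regular_step[OF R1] unfolding eq by (simp add: cubic_regular_commute)
  next
    case 2
    have "cubic_quotient (u' + 1) (v' + 1) c = cubic_quotient (v' + 1) (u' + 1) c"
      by (rule cubic_quotient_commute)
    also have "\<dots> = cubic_quotient (u' + 1) v' c"
      by (subst cubic_quotient_step[OF R1]) (rule cubic_quotient_commute)
    also have "\<dots> = cubic_quotient u v c"
      using cubic_quotient_step[OF IH(1)] IH(2) by simp
    finally show ?case unfolding eq .
  }
qed (use assms in simp_all)

section \<open>Exchange of limit and sum for large parameters\<close>

text \<open>The majorant is the binomial series of (1 - x) to the power -|c| at x = 1/2 and does not
  involve \<open>u\<close> and \<open>v\<close>. The bound 9 on \<open>Re a\<close> keeps the
  quotient with + 3 below 4/3, and \<open>Re w\<close> at least twice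
  \<open>norm (2 * c - 1)\<close> keeps (a + k)/(w + k) below 3/2. The product of these, divided by
  4, is the 1/2 of the majorant.\<close>

lemma norm_cubic_term_le:
  fixes u v c :: complex
  defines "a \<equiv> u + v - 3/2" and "w \<equiv> u + v - 1/2 - 2 * c"
  assumes a: "Re a \<ge> 9" and w: "Re w \<ge> 1" "Re w \<ge> 2 * norm (2 * c - 1)"
    and u: "Re u \<ge> 1" "Re u \<ge> norm (u - v + 1/2)" and v: "Re v \<ge> 1" "Re v \<ge> norm (v - u + 1/2)"
  shows "norm (cubic_term u v c k / a) \<le> pochhammer (norm c) k / (fact k * 2 ^ k)"
proof (induction k)
  case 0
  then show ?case by (simp add: cubic_term_0 a_def norm_divide)
next
  case (Suc k)
  have nonpos: "a \<notin> \<int>\<^sub>\<le>\<^sub>0"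
    using a by (auto elim!: nonpos_Ints_cases)
  have le: "Re z + real j \<le> norm (z + of_nat j)" for z j
    using complex_Re_le_cmod[of "z + of_nat j"] by simp
  have "norm (a + 3 * of_nat k + 3) \<le> 4/3 * norm (a + 3 * of_nat k)"
    using le[of a "3 * k"] norm_triangle_ineq[of "a + 3 * of_nat k" 3] a by simp
  moreover have "norm (a + 3 * of_nat k) > 0"
    using le[of a "3 * k"] a by (simp del: zero_less_norm_iff)
  ultimately have 1: "norm ((a + 3 * of_nat k + 3) / (a + 3 * of_nat k)) \<le> 4/3"
    unfolding norm_divide by (simp add: pos_divide_le_eq)
  have "a + of_nat k = (w + of_nat k) + (2 * c - 1)"
    by (simp add: a_def w_def)
  then have "norm (a + of_nat k) \<le> norm (w + of_nat k) + norm (2 * c - 1)"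
    by (simp only: norm_triangle_ineq)
  then have "norm (a + of_nat k) \<le> 3/2 * norm (w + of_nat k)"
    using le[of w k] w by simp
  moreover have "norm (w + of_nat k) > 0"
    using le[of w k] w by (simp del: zero_less_norm_iff)
  ultimately have 2: "norm ((a + of_nat k) / (w + of_nat k)) \<le> 3/2"
    unfolding norm_divide by (simp add: pos_divide_le_eq)
  have le1: "norm ((x + of_nat k) / (y + of_nat k)) \<le> 1" if "Re y \<ge> 1" "Re y \<ge> norm x" for x y
  proof -
    have "norm (x + of_nat k) \<le> norm (y + of_nat k)" "norm (y + of_nat k) > 0"
      using that le[of y k] norm_triangle_ineq[of x "of_nat k"]
      by (simp_all del: zero_less_norm_iff)
    then show ?thesis unfolding norm_divide by (simp add: pos_divide_le_eq)
  qed
  have 5: "norm ((c + of_nat k) / (1 + of_nat k)) \<le> (norm c + real k) / (1 + real k)"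
  proof -
    have "norm (1 + of_nat k :: complex) = 1 + real k"
      by (metis norm_of_nat of_nat_Suc)
    then show ?thesis
      using norm_triangle_ineq[of c "of_nat k"] by (simp add: norm_divide divide_right_mono)
  qed
  have pochhammer_ge_0: "pochhammer (norm c) k \<ge> 0"
    by (simp add: pochhammer_prod prod_nonneg)
  have "norm (cubic_term u v c (Suc k) / a) = norm (cubic_term u v c k / a) *
     (norm ((a + 3 * of_nat k + 3) / (a + 3 * of_nat k)) *
     norm ((a + of_nat k) / (w + of_nat k)) * norm ((u - v + 1/2 + of_nat k) / (u + of_nat k)) *
     norm ((v - u + 1/2 + of_nat k) / (v + of_nat k)) * norm ((c + of_nat k) / (1 + of_nat k)) / 4)"
    unfolding cubic_term_Suc[OF nonpos[unfolded a_def]] a_def[symmetric] w_def[symmetric]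
    by (simp add: norm_mult norm_divide)
  also have "\<dots> \<le> pochhammer (norm c) k / (fact k * 2 ^ k) *
     (4/3 * (3/2) * 1 * 1 * ((norm c + real k) / (1 + real k)) / 4)"
    by (intro mult_mono divide_right_mono Suc.IH 1 2 5 le1 u v mult_nonneg_nonneg divide_nonneg_nonneg
        prod_nonneg pochhammer_ge_0) auto
  also have "\<dots> = pochhammer (norm c) (Suc k) / (fact (Suc k) * 2 ^ Suc k)"
  proof -
    have "P / (F * T) * (4/3 * (3/2) * 1 * 1 * (x / y) / 4) = (P * x) / ((y * F) * (2 * T))"
      for P F T x y :: real
      by (simp add: mult_ac)
    then show ?thesis
      unfolding pochhammer_Suc fact_Suc power_Suc of_nat_Suc .
  qed
  finally show ?case .
qed

text \<open>Shifting both arguments by \<open>n\<close> leaves u - v fixed, so two quotients in the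
  term ratio have bounded numerators over growing denominators. Relative to the term at 0, all
  others vanish in the limit, and the uniform majorant permits Tannery's theorem.\<close>

lemma suminf_cubic_term_asymptotics:
  "(\<lambda>n. suminf (cubic_term (u + of_nat n) (v + of_nat n) c) / (u + v - 3/2 + 2 * of_nat n)) \<longlonglongrightarrow> 1"
proof -
  define a w where aw: "a = u + v - 3/2" "w = u + v - 1/2 - 2 * c"
  \<comment> \<open>A sum of all the norms involved, so that a single threshold for \<open>n\<close>
    secures every hypothesis of \<open>norm_cubic_term_le\<close>.\<close>
  define X where "X = 9 + norm a + norm w + norm u + norm v + 2 * norm (2 * c - 1)
    + norm (u - v + 1/2) + norm (v - u + 1/2)"
  define f where "f k n = cubic_term (u + of_nat n) (v + of_nat n) c k / (a + 2 * of_nat n)" for k n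
  have large: "Re a + 2 * real n \<ge> 9" "Re w + 2 * real n \<ge> 1" "Re w + 2 * real n \<ge> 2 * norm (2 * c - 1)"
    "Re u + real n \<ge> 1" "Re u + real n \<ge> norm (u - v + 1/2)" "Re v + real n \<ge> 1"
    "Re v + real n \<ge> norm (v - u + 1/2)" if "real n \<ge> X" for n
    using that abs_Re_le_cmod[of a] abs_Re_le_cmod[of w] abs_Re_le_cmod[of u] abs_Re_le_cmod[of v]
      norm_ge_zero[of "2 * c - 1"] norm_ge_zero[of "u - v + 1/2"] norm_ge_zero[of "v - u + 1/2"]
    unfolding X_def by linarith+
  have eqs: "u + of_nat n + (v + of_nat n) - 3/2 = a + 2 * of_nat n"
    "u + of_nat n + (v + of_nat n) - 1/2 - 2 * c = w + 2 * of_nat n"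
    "u + of_nat n - (v + of_nat n) + 1/2 = u - v + 1/2"
    "v + of_nat n - (u + of_nat n) + 1/2 = v - u + 1/2" for n
    by (simp_all add: aw)
  have ev: "\<forall>\<^sub>F n in sequentially. real n \<ge> X"
    by (simp add: eventually_at_top_linorder) (metis real_arch_simple order_trans of_nat_le_iff)
  have a_nonpos: "a + 2 * of_nat n \<notin> \<int>\<^sub>\<le>\<^sub>0" if "real n \<ge> X" for n
    using large(1)[OF that] by (auto elim!: nonpos_Ints_cases dest!: arg_cong[of _ _ Re])
  have lim: "f k \<longlonglongrightarrow> (if k = 0 then 1 else 0)" for k
  proof (induction k)
    case 0
    have "\<forall>\<^sub>F n in sequentially. f 0 n = 1"
      using ev
    proof eventually_elim
      case (elim n)
      then have "a + 2 * of_nat n \<noteq> 0"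
        using a_nonpos[OF elim] by auto
      then show ?case
        unfolding f_def cubic_term_0 eqs by simp
    qed
    then show ?case by (simp add: tendsto_eventually)
  next
    case (Suc k)
    have q2: "(\<lambda>n. (x + 2 * of_nat n) / (y + 2 * of_nat n)) \<longlonglongrightarrow> 1" for x y :: complex
      using tendsto_shift_quotient[of 2 x y] by simp
    have q0: "(\<lambda>n. x / (y + of_nat n)) \<longlonglongrightarrow> 0" for x y :: complex
      by (intro tendsto_divide_0[OF tendsto_const] tendsto_add_filterlim_at_infinity[OF tendsto_const]
          tendsto_of_nat)
    have "(\<lambda>n. f k n *
      ((a + 3 * of_nat k + 3 + 2 * of_nat n) / (a + 3 * of_nat k + 2 * of_nat n) *
       ((a + of_nat k + 2 * of_nat n) / (w + of_nat k + 2 * of_nat n)) *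
       ((u - v + 1/2 + of_nat k) / (u + of_nat k + of_nat n)) *
       ((v - u + 1/2 + of_nat k) / (v + of_nat k + of_nat n)) *
       ((c + of_nat k) / (1 + of_nat k)) / 4))
      \<longlonglongrightarrow> (if k = 0 then 1 else 0) * (1 * 1 * 0 * 0 * ((c + of_nat k) / (1 + of_nat k)) / 4)"
      by (intro tendsto_mult tendsto_divide[of _ _ _ "\<lambda>_. 4"] q0 q2 tendsto_const Suc.IH) auto
    moreover have "\<forall>\<^sub>F n in sequentially. f k n *
      ((a + 3 * of_nat k + 3 + 2 * of_nat n) / (a + 3 * of_nat k + 2 * of_nat n) *
       ((a + of_nat k + 2 * of_nat n) / (w + of_nat k + 2 * of_nat n)) *
       ((u - v + 1/2 + of_nat k) / (u + of_nat k + of_nat n)) *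
       ((v - u + 1/2 + of_nat k) / (v + of_nat k + of_nat n)) *
       ((c + of_nat k) / (1 + of_nat k)) / 4) = f (Suc k) n"
      using ev
    proof eventually_elim
      case (elim n)
      have "u + of_nat n + (v + of_nat n) - 3/2 \<notin> \<int>\<^sub>\<le>\<^sub>0"
        using a_nonpos[OF elim] unfolding eqs .
      note S = cubic_term_Suc[OF this, of c k, unfolded eqs]
      show ?case
        unfolding f_def S by (simp add: add_ac)
    qed
    ultimately show ?case
      using Lim_transform_eventually by fastforce
  qed
  have bound: "norm (f k n) \<le> pochhammer (norm c) k / (fact k * 2 ^ k)" if "real n \<ge> X" for k n
    unfolding f_def using norm_cubic_term_le[of "u + of_nat n" "v + of_nat n" c k] large[OF that]
    unfolding eqs by simp
  have "summable (\<lambda>k. pochhammer (norm c) k / (fact k * 2 ^ k))"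
  proof (rule summable_ratio_limit)
    show "pochhammer (norm c) (Suc k) / (fact (Suc k) * 2 ^ Suc k) =
      pochhammer (norm c) k / (fact k * 2 ^ k) * ((norm c + real k) / (1 + real k) / 2)" for k
      by (simp add: pochhammer_Suc)
    show "(\<lambda>k. (norm c + real k) / (1 + real k) / 2) \<longlonglongrightarrow> 1 / 2"
      using tendsto_shift_quotient[of 1 "norm c" 1] by (intro tendsto_intros) simp_all
  qed simp
  moreover have "\<forall>\<^sub>F (k, n) in at_top \<times>\<^sub>F sequentially.
      norm (f k n) \<le> pochhammer (norm c) k / (fact k * 2 ^ k)"
    using eventually_prodI[OF eventually_True[of at_top] ev]
    by (rule eventually_mono) (auto intro: bound)
  ultimately have "(\<lambda>n. suminf (\<lambda>k. f k n)) \<longlonglongrightarrow> suminf (\<lambda>k. if k = 0 then 1 else 0)"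
    by (intro tannerys_theorem[OF lim, THEN conjunct2, THEN conjunct2]) auto
  moreover have "suminf (\<lambda>k. if k = 0 then 1 else 0 :: complex) = 1"
    using sums_single[of 0 "\<lambda>_. 1 :: complex"] by (simp add: sums_iff)
  moreover have "\<forall>\<^sub>F n in sequentially. suminf (\<lambda>k. f k n) =
      suminf (cubic_term (u + of_nat n) (v + of_nat n) c) / (a + 2 * of_nat n)"
    using ev
  proof eventually_elim
    case (elim n)
    have "u + of_nat n + (v + of_nat n) - 3/2 \<notin> \<int>\<^sub>\<le>\<^sub>0"
      using a_nonpos[OF elim] unfolding eqs .
    then show ?case
      unfolding f_def by (intro suminf_divide summable_cubic_term)
  qed
  ultimately show ?thesis
    unfolding aw(1)[symmetric] using Lim_transform_eventually by fastforce
qed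

section \<open>Evaluation by Gamma asymptotics\<close>

text \<open>Since \<open>pochhammer z (Suc n)\<close> is a quotient of two Gamma values, the
  expression equals \<open>Gamma z / Gamma_series z n\<close>, and Euler's limit for Gamma
  applies.\<close>

lemma Gamma_shift_asymptotics:
  fixes z :: complex
  assumes "z \<notin> \<int>\<^sub>\<le>\<^sub>0"
  shows "(\<lambda>n. Gamma (z + of_nat (Suc n)) / (fact n * exp (z * of_real (ln (of_nat n))))) \<longlonglongrightarrow> 1"
proof -
  have nz: "Gamma z \<noteq> 0"
    using assms by (simp add: Gamma_eq_zero_iff)
  have "(\<lambda>n. Gamma z / Gamma_series z n) \<longlonglongrightarrow> Gamma z / Gamma z"
    by (intro tendsto_intros Gamma_series_LIMSEQ nz)
  moreover have "Gamma z / Gamma_series z n =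
      Gamma (z + of_nat (Suc n)) / (fact n * exp (z * of_real (ln (of_nat n))))" for n
    using nz unfolding Gamma_series_def Suc_eq_plus1[symmetric] pochhammer_Gamma[OF assms] by simp
  ultimately show ?thesis using nz by simp
qed

text \<open>By invariance the quotient may be computed at arguments shifted by n + 1. Normalising
  each Gamma value by its asymptotics cancels all factorials, and the powers combine to ((2n + 1)/n)
  to the power 2c, with limit 4 to the power \<open>c\<close>.\<close>

lemma cubic_quotient_eq:
  assumes R: "cubic_regular u v c"
  shows "cubic_quotient u v c = exp (2 * c * of_real (ln 2))"
proof -
  define a w where aw: "a = u + v - 3/2" "w = u + v - 1/2 - 2 * c"
  define g where "g z n = Gamma (z + of_nat (Suc n)) / (fact n * exp (z * of_real (ln (of_nat n))))"
    for z :: complex and n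
  have lim_g: "g z \<longlonglongrightarrow> 1" if "z \<notin> \<int>\<^sub>\<le>\<^sub>0" for z
    unfolding g_def using Gamma_shift_asymptotics[OF that] .
  have lim_g': "(\<lambda>n. g z (2 * n + 1)) \<longlonglongrightarrow> 1" if "z \<notin> \<int>\<^sub>\<le>\<^sub>0" for z
    by (rule filterlim_compose[OF lim_g[OF that] filterlim_subseq]) (simp add: strict_mono_def)
  have Gamma_g: "Gamma (z + of_nat (Suc n)) = g z n * (fact n * exp (z * of_real (ln (of_nat n))))" for z n
    by (simp add: g_def)
  have nonpos: "a + 1 \<notin> \<int>\<^sub>\<le>\<^sub>0" "a \<notin> \<int>\<^sub>\<le>\<^sub>0" "u \<notin> \<int>\<^sub>\<le>\<^sub>0" "v \<notin> \<int>\<^sub>\<le>\<^sub>0" "w \<notin> \<int>\<^sub>\<le>\<^sub>0" "u - c \<notin> \<int>\<^sub>\<le>\<^sub>0" "v - c \<notin> \<int>\<^sub>\<le>\<^sub>0"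
    using R add_of_nat_notin_nonpos_Ints[of a 1] unfolding cubic_regular_def aw by simp_all
  define h where "h n = suminf (cubic_term (u + of_nat n) (v + of_nat n) c) / (a + 2 * of_nat n)" for n
  have "(\<lambda>n. ln (2 + inverse (real n))) \<longlonglongrightarrow> ln (2 + 0)"
    by (intro tendsto_intros lim_inverse_n) simp
  moreover have "\<forall>\<^sub>F n in sequentially. ln (2 + inverse (real n)) = ln (real (2 * n + 1)) - ln (real n)"
    using eventually_gt_at_top[of 0]
  proof eventually_elim
    case (elim n)
    then have "2 + inverse (real n) = real (2 * n + 1) / real n"
      by (simp add: field_simps)
    with elim show ?case
      by (simp only: ln_div of_nat_0_less_iff) simp
  qed
  ultimately have ln_lim: "(\<lambda>n. ln (real (2 * n + 1)) - ln (real n)) \<longlonglongrightarrow> ln 2"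
    using Lim_transform_eventually by fastforce
  have "cubic_quotient u v c = h (Suc n) * g (a + 1) (2 * n + 1) * g (u - c) n * g (v - c) n
     / (g u n * g v n * g w (2 * n + 1)) * exp (2 * c * of_real (ln (real (2 * n + 1)) - ln (real n)))" for n
  proof -
    define N where "N = (of_nat (Suc n) :: complex)"
    define L M where "L = complex_of_real (ln (real n))" and "M = complex_of_real (ln (real (2 * n + 1)))"
    have nz: "a + 2 * N \<noteq> 0"
      using add_of_nat_neq_0[OF nonpos(2), of "2 * Suc n"] 
      unfolding N_def of_nat_mult of_nat_numeral .
    have nonpos': "a + 2 * N \<notin> \<int>\<^sub>\<le>\<^sub>0"
      using add_of_nat_notin_nonpos_Ints[OF nonpos(2), of "2 * Suc n"]
      unfolding N_def of_nat_mult of_nat_numeral .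
    \<comment> \<open>\<open>a\<close> and \<open>w\<close> move by 2n + 2, the successor of 2n + 1;
      hence the index \<open>2 * n + 1\<close> in the corresponding values of
      \<open>g\<close>.\<close>
    have N2: "2 * N = of_nat (Suc (2 * n + 1))"
      by (simp add: N_def)
    have eqs: "u + N + (v + N) - 3/2 = a + 2 * N" "u + N + (v + N) - 1/2 - 2 * c = w + 2 * N"
      "u + N - c = u - c + N" "v + N - c = v - c + N"
      by (simp_all add: aw)
    have a1: "a + 1 + 2 * N = (a + 2 * N) + 1"
      by simp
    \<comment> \<open>The denominator \<open>a + 2 * N\<close> is the term at 0 of the shifted sum,
      by which \<open>h\<close> normalises that sum.\<close>
    have G1: "Gamma (a + 2 * N) = Gamma (a + 1 + 2 * N) / (a + 2 * N)"
      unfolding a1 Gamma_plus1[OF nonpos'] using nz by simp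
    have "cubic_quotient u v c = cubic_quotient (u + N) (v + N) c"
      unfolding N_def using cubic_quotient_shift(2)[OF R, of "Suc n"] by simp
    also have "\<dots> = h (Suc n) * Gamma (a + 1 + 2 * N) * Gamma (u - c + N) * Gamma (v - c + N)
        / (Gamma (u + N) * Gamma (v + N) * Gamma (w + 2 * N))"
      unfolding cubic_quotient_def eqs G1 h_def N_def[symmetric] by simp
    also have "\<dots> = h (Suc n) * g (a + 1) (2 * n + 1) * g (u - c) n * g (v - c) n
      / (g u n * g v n * g w (2 * n + 1)) *
      (exp ((a + 1) * M) * exp ((u - c) * L) * exp ((v - c) * L) / (exp (u * L) * exp (v * L) * exp (w * M)))"
    proof -
      have "h * (gA * (f2 * eA)) * (gB * (f1 * eB)) * (gC * (f1 * eC))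
          / ((gU * (f1 * eU)) * (gV * (f1 * eV)) * (gW * (f2 * eW)))
        = h * gA * gB * gC / (gU * gV * gW) * (eA * eB * eC / (eU * eV * eW))"
        if "f1 \<noteq> 0" "f2 \<noteq> 0" for h gA gB gC gU gV gW eA eB eC eU eV eW f1 f2 :: complex
        using that by (simp add: mult_ac)
      then show ?thesis
        unfolding N2 unfolding N_def Gamma_g L_def[symmetric] M_def[symmetric]
        by (metis fact_nonzero)
    qed
    also have "exp ((a + 1) * M) * exp ((u - c) * L) * exp ((v - c) * L) / (exp (u * L) * exp (v * L) * exp (w * M))
        = exp (2 * c * (M - L))"
      unfolding exp_add[symmetric] exp_diff[symmetric]
      by (rule arg_cong[of _ _ exp]) (simp add: aw algebra_simps)
    finally show ?thesis
      by (simp add: L_def M_def)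
  qed
  moreover have "(\<lambda>n. h (Suc n) * g (a + 1) (2 * n + 1) * g (u - c) n * g (v - c) n
     / (g u n * g v n * g w (2 * n + 1)) * exp (2 * c * of_real (ln (real (2 * n + 1)) - ln (real n))))
     \<longlonglongrightarrow> 1 * 1 * 1 * 1 / (1 * 1 * 1) * exp (2 * c * of_real (ln 2))"
  proof -
    have "h \<longlonglongrightarrow> 1"
      unfolding h_def aw by (rule suminf_cubic_term_asymptotics)
    then have "(\<lambda>n. h (Suc n)) \<longlonglongrightarrow> 1"
      by (rule LIMSEQ_Suc)
    then show ?thesis
      by (intro tendsto_mult tendsto_divide tendsto_exp tendsto_of_real lim_g lim_g' nonpos ln_lim tendsto_const)
        auto
  qed
  ultimately have "(\<lambda>n::nat. cubic_quotient u v c) \<longlonglongrightarrow> exp (2 * c * of_real (ln 2))"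
    by simp
  then show ?thesis
    by (simp only: LIMSEQ_const_iff)
qed

theorem suminf_cubic_term:
  assumes R: "cubic_regular u v c"
  shows "suminf (cubic_term u v c) = exp (2 * c * of_real (ln 2)) *
    (Gamma u * Gamma v * Gamma (u + v - 1/2 - 2 * c)) / (Gamma (u + v - 3/2) * Gamma (u - c) * Gamma (v - c))"
proof -
  have "s = e * y / (x1 * x2 * x3)"
    if "s * x1 * x2 * x3 / y = e" "x1 \<noteq> 0" "x2 \<noteq> 0" "x3 \<noteq> 0" "y \<noteq> 0" for s x1 x2 x3 y e :: complex
    using that by (simp add: nonzero_eq_divide_eq nonzero_divide_eq_eq mult.assoc)
  from this[OF cubic_quotient_eq[OF R, unfolded cubic_quotient_def]] R show ?thesis
    unfolding cubic_regular_def by (simp only: Gamma_eq_zero_iff mult_eq_0_iff simp_thms)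
qed

section \<open>Half-integers, reflection and shifted factorials\<close>

lemma half_odd_notin_nonpos_Ints:
  fixes z :: complex
  assumes "2 * z = of_int k" "odd k"
  shows "z \<notin> \<int>\<^sub>\<le>\<^sub>0"
proof
  assume "z \<in> \<int>\<^sub>\<le>\<^sub>0"
  then obtain j where "z = of_int j"
    by (auto elim!: nonpos_Ints_cases)
  with assms(1) have "of_int (2 * j) = (of_int k :: complex)"
    by simp
  then have "2 * j = k"
    by (simp only: of_int_eq_iff)
  with assms(2) show False by auto
qed

text \<open>The functional equation reduces both values to Gamma(1/2), whose square is pi.\<close>

lemma Gamma_three_halves_mult_Gamma_minus_half:
  "Gamma (3/2 :: complex) * Gamma (- 1/2) = - of_real pi"
proof -
  have nonpos: "(1/2 :: complex) \<notin> \<int>\<^sub>\<le>\<^sub>0" "(- 1/2 :: complex) \<notin> \<int>\<^sub>\<le>\<^sub>0"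
    using half_odd_notin_nonpos_Ints[of "1/2" 1] half_odd_notin_nonpos_Ints[of "-1/2" "-1"] by simp_all
  have "Gamma (3/2 :: complex) = 1/2 * Gamma (1/2)"
    using Gamma_plus1[OF nonpos(1)] by simp
  moreover have "Gamma (1/2 :: complex) = - 1/2 * Gamma (- 1/2)"
    using Gamma_plus1[OF nonpos(2)] by simp
  ultimately have "Gamma (3/2 :: complex) * Gamma (- 1/2) = - (Gamma (1/2) ^ 2)"
    by (simp add: power2_eq_square)
  then show ?thesis
    by (simp add: Gamma_one_half_complex flip: of_real_power)
qed

text \<open>The sine in the reflection formula is taken at 3 pi/2 plus a multiple of 2 pi, so it is
  -1 for every \<open>q\<close>.\<close>

lemma Gamma_half_odd_reflection:
  "Gamma (2 * of_int q + 3/2 :: complex) * Gamma (- 1/2 - 2 * of_int q) = - of_real pi"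
proof -
  have "sin (of_real pi * (2 * of_int q + 3/2) :: complex) = of_real (sin (pi * (2 * of_int q + 3/2)))"
    by (simp flip: sin_of_real)
  also have "sin (pi * (2 * of_int q + 3/2)) = sin (3/2 * pi + (2 * pi) * of_int q)"
    by (simp add: algebra_simps)
  also have "\<dots> = - 1"
    by (simp only: sin_add sin_int_2pin cos_int_2pin sin_3over2_pi)
  finally have s: "sin (of_real pi * (2 * of_int q + 3/2) :: complex) = - 1"
    by simp
  have e: "1 - (2 * of_int q + 3/2) = (- 1/2 - 2 * of_int q :: complex)"
    by simp
  show ?thesis
    using Gamma_reflection_complex[of "2 * of_int q + 3/2"] unfolding s e by simp
qed

text \<open>Separates the dependence on \<open>k\<close> from an integer offset of either sign;
  likewise \<open>Gamma_of_int_fact\<close> for the factorials.\<close>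

lemma shifted_factorial_pochhammer:
  assumes "x + of_int n \<notin> \<int>\<^sub>\<le>\<^sub>0"
  shows "shifted_factorial x (int k + n) = pochhammer (x + of_int n) k * Gamma (x + of_int n) / Gamma x"
  using assms by (simp add: shifted_factorial_def pochhammer_Gamma Gamma_eq_zero_iff add_ac)

lemma of_int_pos_notin_nonpos_Ints:
  assumes "n > 0"
  shows "(of_int n :: complex) \<notin> \<int>\<^sub>\<le>\<^sub>0"
  using assms by (auto elim!: nonpos_Ints_cases)

lemma Gamma_of_int_fact:
  assumes "n \<ge> 0"
  shows "fact (nat (int k + n)) = (pochhammer (of_int (n + 1)) k * Gamma (of_int (n + 1)) :: complex)"
proof -
  have "(of_int (n + 1) :: complex) \<notin> \<int>\<^sub>\<le>\<^sub>0"
    using assms by (intro of_int_pos_notin_nonpos_Ints) simp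
  then have "pochhammer (of_int (n + 1)) k * Gamma (of_int (n + 1)) = Gamma (of_int (n + 1) + of_nat k :: complex)"
    by (simp add: pochhammer_Gamma Gamma_eq_zero_iff)
  also have "of_int (n + 1) + of_nat k = 1 + (of_nat (nat (int k + n)) :: complex)"
    using assms by simp
  finally show ?thesis by (simp add: Gamma_fact)
qed

lemma exp_odd_ln_2: "exp ((1 + 2 * of_int r) * of_real (ln 2)) = (2 * 4 powi r :: complex)"
proof -
  have "exp ((1 + 2 * of_int r) * of_real (ln 2)) = complex_of_real (exp ((1 + 2 * of_int r) * ln 2))"
    by (simp flip: exp_of_real)
  also have "exp ((1 + 2 * of_int r) * ln 2) = 2 powr (of_int (1 + 2 * r) :: real)"
    by (simp add: powr_def)
  also have "\<dots> = 2 powi (1 + 2 * r)"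
    by (subst powr_real_of_int') auto
  also have "\<dots> = 2 * 4 powi r"
    by (simp add: power_int_add power_int_mult)
  finally show ?thesis by simp
qed

section \<open>Specialisation to the series for 1/pi\<close>

text \<open>The summand is a constant multiple of \<open>cubic_term\<close>, whose sum is known. The
  reflection products of \<open>b\<close> and of 3/2 are both -pi and cancel, so \<open>q\<close>
  remains only in the arguments of the last two Gamma values.\<close>

lemma pi_series_sums:
  assumes "min (p + q + 1) (p - q) \<ge> 0"
  shows "pi_series_term p q r sums
    (Gamma (1/2 + of_int r)
      / (Gamma (1/2) * Gamma (1/2 + of_int (p + q - r + 1)) * Gamma (1/2 + of_int (p - q - r))))"
proof -
  define u v c a b w :: complex where defs: "u = of_int (p + q + 1 + 1)" "v = of_int (p - q + 1)"
    "c = 1/2 + of_int r" "a = 3/2 + of_int (2 * p)" "b = 3/2 + of_int (2 * q)"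
    "w = 3/2 + of_int (2 * p - 2 * r)"
  have b': "- 1/2 + of_int (- 2 * q) = 1 - b"
    by (simp add: defs)
  have eqs: "u + v - 3/2 = a" "u + v - 1/2 - 2 * c = w" "u - v + 1/2 = b" "v - u + 1/2 = 1 - b"
    by (simp_all add: defs)
  have half: "a \<notin> \<int>\<^sub>\<le>\<^sub>0" "b \<notin> \<int>\<^sub>\<le>\<^sub>0" "1 - b \<notin> \<int>\<^sub>\<le>\<^sub>0" "c \<notin> \<int>\<^sub>\<le>\<^sub>0" "w \<notin> \<int>\<^sub>\<le>\<^sub>0"
    "u - c \<notin> \<int>\<^sub>\<le>\<^sub>0" "v - c \<notin> \<int>\<^sub>\<le>\<^sub>0" "(1/2 :: complex) \<notin> \<int>\<^sub>\<le>\<^sub>0" "(3/2 :: complex) \<notin> \<int>\<^sub>\<le>\<^sub>0" "(-1/2 :: complex) \<notin> \<int>\<^sub>\<le>\<^sub>0"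
    using half_odd_notin_nonpos_Ints[of a "3 + 4 * p"] half_odd_notin_nonpos_Ints[of b "3 + 4 * q"]
      half_odd_notin_nonpos_Ints[of "1 - b" "- 1 - 4 * q"] half_odd_notin_nonpos_Ints[of c "1 + 2 * r"]
      half_odd_notin_nonpos_Ints[of w "3 + 4 * p - 4 * r"]
      half_odd_notin_nonpos_Ints[of "u - c" "3 + 2 * p + 2 * q - 2 * r"]
      half_odd_notin_nonpos_Ints[of "v - c" "1 + 2 * p - 2 * q - 2 * r"]
      half_odd_notin_nonpos_Ints[of "1/2" 1] half_odd_notin_nonpos_Ints[of "3/2" 3]
      half_odd_notin_nonpos_Ints[of "-1/2" "-1"]
    by (simp_all add: defs algebra_simps)
  \<comment> \<open>Here the hypothesis on \<open>p\<close> and \<open>q\<close> enters: it makes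
    \<open>u\<close> and \<open>v\<close> positive integers. The other arguments are halves of odd
    integers.\<close>
  have int: "u \<notin> \<int>\<^sub>\<le>\<^sub>0" "v \<notin> \<int>\<^sub>\<le>\<^sub>0"
    using assms unfolding defs(1,2) by (auto intro!: of_int_pos_notin_nonpos_Ints simp del: of_int_add of_int_diff)
  have R: "cubic_regular u v c"
    using half int by (simp add: cubic_regular_def eqs)
  \<comment> \<open>The factors independent of \<open>k\<close>. The leading 2 comes from 6k + 4p +
    3 = 2 (a + 3k); of the three Gamma(3/2), the one in the denominator factorial cancels one of the
    two others.\<close>
  define K where "K = 2 * Gamma a * Gamma b * Gamma (1 - b) * Gamma c
     / (Gamma (3/2) * Gamma (-1/2) * Gamma (1/2) * Gamma u * Gamma v * Gamma w * 4 powi (r + 1))"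
  have term_eq: "pi_series_term p q r k = K * cubic_term u v c k" for k
  proof -
    have rearrange: "(A * Ga / g3) * (B * Gb / g3) * (Q * Gq / gm) * (C * Gc / g1)
        / (F * (U * Gu) * (V * Gv) * (W * Gw / g3)) * (2 * x / (y * z))
      = 2 * Ga * Gb * Gq * Gc / (g3 * gm * g1 * Gu * Gv * Gw * y) * (x * A * B * Q * C / (F * U * V * W * z))"
      if "g3 \<noteq> 0" for A B C Q F U V W Ga Gb Gq Gc Gu Gv Gw g3 gm g1 x y z :: complex
      using that by (simp add: mult_ac)
    have E1: "shifted_factorial (3/2) (int k + 2 * p) = pochhammer a k * Gamma a / Gamma (3/2)"
      "shifted_factorial (3/2) (int k + 2 * q) = pochhammer b k * Gamma b / Gamma (3/2)"
      "shifted_factorial (-1/2) (int k - 2 * q) = pochhammer (1 - b) k * Gamma (1 - b) / Gamma (-1/2)"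
      "shifted_factorial (1/2) (int k + r) = pochhammer c k * Gamma c / Gamma (1/2)"
      "shifted_factorial (3/2) (int k + 2 * p - 2 * r) = pochhammer w k * Gamma w / Gamma (3/2)"
      using shifted_factorial_pochhammer[of "3/2" "2 * p" k] shifted_factorial_pochhammer[of "3/2" "2 * q" k]
        shifted_factorial_pochhammer[of "-1/2" "- 2 * q" k] shifted_factorial_pochhammer[of "1/2" r k]
        shifted_factorial_pochhammer[of "3/2" "2 * p - 2 * r" k] half
      unfolding b' defs(3-6)[symmetric] by (simp_all add: add_diff_eq)
    have E2: "fact (nat (int k + p + q + 1)) = pochhammer u k * Gamma u"
      "fact (nat (int k + p - q)) = pochhammer v k * Gamma v"
      using Gamma_of_int_fact[of "p + q + 1" k] Gamma_of_int_fact[of "p - q" k] assms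
      unfolding defs(1,2) by (simp_all add: add_ac add_diff_eq)
    have E3: "of_int (6 * int k + 4 * p + 3) = 2 * (a + 3 * of_nat k)"
      by (simp add: defs)
    have E4: "(4 :: complex) powi (int k + r + 1) = 4 powi (r + 1) * 4 ^ k"
      by (simp add: power_int_add)
    have "Gamma (3/2 :: complex) \<noteq> 0"
      using half by (simp add: Gamma_eq_zero_iff)
    then show ?thesis
      unfolding pi_series_term_def cubic_term_def eqs K_def E1 E2 E3 E4 by (rule rearrange)
  qed
  have summable: "summable (cubic_term u v c)"
    using summable_cubic_term[of u v c] half unfolding eqs by simp
  have "2 * c = 1 + 2 * of_int r"
    by (simp add: defs)
  \<comment> \<open>This is 4 to the power r + 1/2; together with the 2 in \<open>K\<close> it
    cancels \<open>4 powi (r + 1)\<close>.\<close>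
  then have four: "exp (2 * c * of_real (ln 2)) = 2 * 4 powi r"
    by (simp only: exp_odd_ln_2)
  have "(\<Sum>k. pi_series_term p q r k) = K * suminf (cubic_term u v c)"
    unfolding term_eq by (rule suminf_mult[OF summable])
  also have "\<dots> = (Gamma b * Gamma (1 - b)) * Gamma c
      / ((Gamma (3/2) * Gamma (-1/2)) * Gamma (1/2) * Gamma (u - c) * Gamma (v - c))"
    unfolding suminf_cubic_term[OF R] eqs K_def four
    using half int by (simp add: Gamma_eq_zero_iff power_int_add mult_ac)
  also have "\<dots> = Gamma c / (Gamma (1/2) * Gamma (u - c) * Gamma (v - c))"
  proof -
    have "Gamma b * Gamma (1 - b) = - of_real pi"
      using Gamma_half_odd_reflection[of q] unfolding b'[symmetric] defs(5) by (simp add: add.commute)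
    then show ?thesis
      unfolding Gamma_three_halves_mult_Gamma_minus_half by simp
  qed
  finally have sum: "(\<Sum>k. pi_series_term p q r k) = Gamma c / (Gamma (1/2) * Gamma (u - c) * Gamma (v - c))" .
  have uvc: "u - c = 1/2 + of_int (p + q - r + 1)" "v - c = 1/2 + of_int (p - q - r)"
    by (simp_all add: defs)
  have "summable (pi_series_term p q r)"
    unfolding term_eq[abs_def] by (rule summable_mult[OF summable])
  then show ?thesis
    using sum unfolding uvc by (simp only: sums_iff simp_thms defs(3))
qed

theorem theorem2:
  fixes p q r :: int
  assumes "min (p + q + 1) (p - q) \<ge> 0"
  shows "summable (pi_series_term p q r)
    \<and> 1 / complex_of_real pi =
        (shifted_factorial (1/2) (p + q - r + 1) * shifted_factorial (1/2) (p - q - r))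
        / shifted_factorial (1/2) r
        * (\<Sum>k. pi_series_term p q r k)"
proof -
  have half: "Gamma (1/2 + of_int n :: complex) \<noteq> 0" for n
    using half_odd_notin_nonpos_Ints[of "1/2 + of_int n" "1 + 2 * n"] by (simp add: Gamma_eq_zero_iff)
  have half0: "Gamma (1/2 :: complex) \<noteq> 0"
    using half[of 0] by simp
  have Gamma_half_sq: "complex_of_real pi = Gamma (1/2) * Gamma (1/2)"
    by (simp add: Gamma_one_half_complex flip: of_real_mult)
  \<comment> \<open>The three shifted factorials contribute one 1/Gamma(1/2) and the sum another;
    their product is 1/pi, while \<open>x\<close>, \<open>y\<close>, \<open>z\<close>
    cancel.\<close>
  have cancel: "1 / (g * g) = x / g * (y / g) / (z / g) * (z / (g * x * y))"
    if "g \<noteq> 0" "x \<noteq> 0" "y \<noteq> 0" "z \<noteq> 0" for g x y z :: complex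
    using that by simp
  from pi_series_sums[OF assms, of r]
  have "summable (pi_series_term p q r)" and sum: "(\<Sum>k. pi_series_term p q r k) = Gamma (1/2 + of_int r)
      / (Gamma (1/2) * Gamma (1/2 + of_int (p + q - r + 1)) * Gamma (1/2 + of_int (p - q - r)))"
    by (simp_all only: sums_iff)
  moreover have "1 / complex_of_real pi =
        (shifted_factorial (1/2) (p + q - r + 1) * shifted_factorial (1/2) (p - q - r))
        / shifted_factorial (1/2) r * (\<Sum>k. pi_series_term p q r k)"
    unfolding shifted_factorial_def sum Gamma_half_sq by (rule cancel) (rule half0 half)+
  ultimately show ?thesis by blast
qed

end
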